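(* Let $G,H$ be locally compact Polish groups and let $f:G\to H$ be a Haar measurable function. If $\Delta_g f:G\to H$ is continuous for every $g\in G$, then $f:G\to H$ is also continuous.
   Context: Groups are written multiplicatively and are not assumed commutative. For $g\in G$ and a function $f:G\to H$, the function $\Delta_g f:G\to H$ is defined by $\Delta_g f(x)=f(gx)f(x)^{-1}$ for $x\in G$. A function $G\to H$ is Haar measurable if the preimage of every open set is a Haar measurable subset of $G$, i.e. measurable with respect to the completion of Haar measure on the Borel sets of $G$. *)

theory Defs
  imports "HOL-Analysis.Analysis"
begin

text \<open>Groups are types of class \<open>topological_group_add\<close>, whose operation is written
  additively but is not assumed to be commutative: \<open>x + y\<close> is the product \<open>xy\<close>, \<open>- x\<close> is
  \<open>x\<^sup>-\<^sup>1\<close>, and \<open>x - y = x + (- y)\<close> is \<open>xy\<^sup>-\<^sup>1\<close>.\<close>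

definition left_diff :: "'a::group_add \<Rightarrow> ('a \<Rightarrow> 'b::group_add) \<Rightarrow> 'a \<Rightarrow> 'b" where
  "left_diff g f = (\<lambda>x. f (g + x) - f x)"

text \<open>Regularity is not listed below: on a locally compact Polish group every Borel measure that is
  finite on compact sets is regular.\<close>

definition haar_measure :: "'a::{topological_group_add, t2_space} measure \<Rightarrow> bool" where
  "haar_measure \<mu> \<longleftrightarrow>
     sets \<mu> = sets borel \<and>
     emeasure \<mu> UNIV \<noteq> 0 \<and>
     (\<forall>K. compact K \<longrightarrow> emeasure \<mu> K < \<infinity>) \<and>
     (\<forall>g. \<forall>A\<in>sets borel. emeasure \<mu> ((+) g ` A) = emeasure \<mu> A)"

text \<open>On a locally compact group, Haar measure exists and is unique up to a positive factor, which
  does not affect the completed sigma-algebra; so the choice of \<open>\<mu>\<close> is immaterial.\<close>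

definition haar_measurable ::
    "('a::{topological_group_add, t2_space} \<Rightarrow> 'b::topological_space) \<Rightarrow> bool" where
  "haar_measurable f \<longleftrightarrow>
     (\<exists>\<mu>. haar_measure \<mu> \<and> (\<forall>U. open U \<longrightarrow> f -` U \<in> sets (completion \<mu>)))"

end

theory Submission imports Defs begin

text \<open>Since \<open>f(gx) = \<Delta>\<^sub>g f(x) f(x)\<close>, continuity at one point gives continuity everywhere, and by
  Baire category it suffices that every nonempty open set contains a nonempty open set on which \<open>f\<close>
  oscillates arbitrarily little. Each \<open>\<Delta>\<^sub>g f\<close> is continuous at \<open>1\<close>, so countable additivity gives a
  set \<open>L\<close> of positive measure in which every \<open>g\<close> has \<open>\<Delta>\<^sub>g f\<close> almost constant on a common
  neighbourhood \<open>N\<close> of \<open>1\<close>; after shrinking \<open>L\<close>, also \<open>f\<close> is almost constant on \<open>L\<close>, and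
  \<open>L\<^sup>-\<^sup>1 L \<subseteq> N\<close>. By Steinhaus, every \<open>g\<close> near \<open>1\<close> has some \<open>b \<in> L\<close> with \<open>gb \<in> L\<close>, and the cocycle
  identity \<open>\<Delta>\<^sub>g f(bx) = \<Delta>\<^bsub>gb\<^esub> f(x) \<Delta>\<^sub>b f(x)\<^sup>-\<^sup>1\<close> with \<open>x = b\<^sup>-\<^sup>1 x\<^sub>0\<close> shows that \<open>\<Delta>\<^sub>g f(x\<^sub>0)\<close> is
  near \<open>1\<close> for any fixed \<open>x\<^sub>0 \<in> L\<close>. Measurability of \<open>g \<mapsto> \<Delta>\<^sub>g f(x)\<close> needs that right translations
  preserve null sets of a left Haar measure.\<close>

section \<open>Neighbourhoods and translates in topological groups\<close>

text \<open>Continuity of subtraction at \<open>(0, 0)\<close> gives a ball, and halving its radius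
  keeps the closure inside. Closures are allowed because smallness is later imposed as a closed
  condition.\<close>

lemma nbhd_diff:
  fixes W :: "'a::{topological_group_add, metric_space} set"
  assumes "open W" "0 \<in> W"
  obtains V where "open V" "0 \<in> V" "\<And>a b. a \<in> closure V \<Longrightarrow> b \<in> closure V \<Longrightarrow> a - b \<in> W"
proof -
  have "open ((\<lambda>p::'a \<times> 'a. fst p - snd p) -` W)"
    by (intro open_vimage continuous_intros assms)
  then obtain A B where AB: "open A" "open B" "(0, 0) \<in> A \<times> B"
      "A \<times> B \<subseteq> (\<lambda>p::'a \<times> 'a. fst p - snd p) -` W"
    by (rule open_prod_elim[of _ "(0, 0)"]) (use assms in auto)
  then obtain e where e: "e > 0" "ball 0 e \<subseteq> A \<inter> B"
    by (metis IntI SigmaE2 open_Int open_contains_ball)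
  have "closure (ball (0::'a) (e/2)) \<subseteq> cball 0 (e/2)"
    by (rule closure_minimal) auto
  also have "\<dots> \<subseteq> A \<inter> B"
    using e by (auto simp: subset_iff)
  finally have "a - b \<in> W" if "a \<in> closure (ball 0 (e/2))" "b \<in> closure (ball 0 (e/2))" for a b
    using that subsetD[OF AB(4), of "(a, b)"] by auto
  with e(1) show thesis
    by (intro that[of "ball 0 (e/2)"]) auto
qed

lemma left_translate_eq_vimage: "(+) (g::'a::group_add) ` A = (\<lambda>x. - g + x) -` A"
  by (force simp: image_iff add.assoc[symmetric])

lemma right_translate_eq_vimage: "(\<lambda>x. x + (g::'a::group_add)) ` A = (\<lambda>x. x - g) -` A"
  by (force simp: image_iff)

lemma open_left_translate:
  fixes A :: "'a::topological_group_add set"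
  shows "open A \<Longrightarrow> open ((+) g ` A)"
  unfolding left_translate_eq_vimage by (intro open_vimage continuous_intros)

lemma open_right_translate:
  fixes A :: "'a::topological_group_add set"
  shows "open A \<Longrightarrow> open ((\<lambda>x. x + g) ` A)"
  unfolding right_translate_eq_vimage by (intro open_vimage continuous_intros)

lemma countable_open_subcover:
  fixes B :: "'i \<Rightarrow> 'a::second_countable_topology set"
  assumes "\<And>i. open (B i)" "\<And>x. \<exists>i. x \<in> B i"
  obtains T where "countable T" "(\<Union>i\<in>T. B i) = UNIV"
proof -
  obtain F where F: "F \<subseteq> range B" "countable F" "\<Union>F = \<Union>(range B)"
    by (rule Lindelof[of "range B"]) (use assms(1) in auto)
  obtain T where T: "countable T" "F = B ` T"
    using F(1,2) by (meson countable_subset_image)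
  have "\<Union>F = UNIV" unfolding F(3) using assms(2) by blast
  with T show thesis by (intro that[of T]) auto
qed

lemma countable_left_translates_cover:
  fixes U :: "'a::{topological_group_add, second_countable_topology} set"
  assumes "open U" "u \<in> U"
  obtains T where "countable T" "(\<Union>g\<in>T. (+) g ` U) = UNIV"
proof (rule countable_open_subcover)
  show "open ((+) g ` U)" for g
    by (rule open_left_translate[OF assms(1)])
  have "x \<in> (+) (x - u) ` U" for x
    using assms(2) by (force simp: image_iff)
  then show "\<exists>g. x \<in> (+) g ` U" for x by blast
qed (rule that)

lemma countable_right_translates_cover:
  fixes U :: "'a::{topological_group_add, second_countable_topology} set"
  assumes "open U" "u \<in> U"
  obtains T where "countable T" "(\<Union>g\<in>T. (\<lambda>x. x + g) ` U) = UNIV"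
proof (rule countable_open_subcover)
  show "open ((\<lambda>x. x + g) ` U)" for g
    by (rule open_right_translate[OF assms(1)])
  have "x \<in> (\<lambda>y. y + (- u + x)) ` U" for x
    using assms(2) by (force simp: image_iff add.assoc[symmetric])
  then show "\<exists>g. x \<in> (\<lambda>y. y + g) ` U" for x by blast
qed (rule that)

section \<open>Pieces of positive measure and basic facts on Haar measure\<close>

text \<open>Otherwise \<open>A\<close> would be a countable union of null sets. Used repeatedly to
  shrink a set while keeping its measure positive.\<close>

lemma positive_piece:
  assumes "A \<in> sets M" "emeasure M A > 0" "countable I" "A \<subseteq> (\<Union>i\<in>I. B i)"
    and "\<And>i. i \<in> I \<Longrightarrow> A \<inter> B i \<in> sets M"
  obtains i where "i \<in> I" "emeasure M (A \<inter> B i) > 0"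
proof (rule ccontr)
  note piece = that
  assume "\<not> thesis"
  then have "A \<inter> B i \<in> null_sets M" if "i \<in> I" for i
    using that assms(5)[of i] piece[of i] by (auto simp: null_sets_def zero_less_iff_neq_zero)
  then have "(\<Union>i\<in>I. A \<inter> B i) \<in> null_sets M"
    by (rule null_sets_UN'[OF assms(3)])
  moreover have "(\<Union>i\<in>I. A \<inter> B i) = A"
    using assms(4) by auto
  ultimately show False
    using assms(2) by auto
qed

lemma haar_measure_space: "haar_measure M \<Longrightarrow> space M = UNIV"
  unfolding haar_measure_def by (metis sets_eq_imp_space_eq space_borel)

lemma haar_measure_sets: "haar_measure M \<Longrightarrow> sets M = sets borel"
  unfolding haar_measure_def by simp

lemma haar_measure_translate:
  assumes "haar_measure M" "A \<in> sets M"
  shows "(+) g ` A \<in> sets M" "emeasure M ((+) g ` A) = emeasure M A"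
proof -
  have "(\<lambda>x. - g + x) \<in> borel_measurable borel"
    by (intro borel_measurable_continuous_onI continuous_intros)
  then have "(\<lambda>x. - g + x) -` A \<in> sets borel"
    using measurable_sets_borel assms haar_measure_sets by blast
  then show "(+) g ` A \<in> sets M"
    using assms(1) by (simp add: left_translate_eq_vimage haar_measure_sets)
  show "emeasure M ((+) g ` A) = emeasure M A"
    using assms unfolding haar_measure_def by simp
qed

lemma haar_measure_translate_null:
  assumes "haar_measure M" "A \<in> null_sets M"
  shows "(+) g ` A \<in> null_sets M"
  using haar_measure_translate[OF assms(1)] assms(2) by (auto simp: null_sets_def)

text \<open>Countably many left translates of \<open>U\<close> cover the group, so if
  \<open>U\<close> were null, the whole group would be null.\<close>

lemma haar_measure_open_pos:
  fixes M :: "'a::{topological_group_add, second_countable_topology, t2_space} measure"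
  assumes "haar_measure M" "open U" "U \<noteq> {}"
  shows "emeasure M U > 0"
proof (rule ccontr)
  assume "\<not> ?thesis"
  then have U: "U \<in> null_sets M"
    using assms by (auto simp: null_sets_def haar_measure_sets)
  obtain u where "u \<in> U"
    using assms(3) by auto
  then obtain T where T: "countable T" "(\<Union>g\<in>T. (+) g ` U) = UNIV"
    by (rule countable_left_translates_cover[OF assms(2)])
  have "(\<Union>g\<in>T. (+) g ` U) \<in> null_sets M"
    by (rule null_sets_UN'[OF T(1)]) (rule haar_measure_translate_null[OF assms(1) U])
  with T(2) assms(1) show False
    by (simp add: haar_measure_def null_sets_def)
qed

lemma countable_precompact_open_cover:
  assumes "locally compact (UNIV :: 'a::{second_countable_topology, t2_space} set)"
  obtains F :: "'a::{second_countable_topology, t2_space} set set" where "countable F" "\<Union>F = UNIV"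
    "\<And>Q. Q \<in> F \<Longrightarrow> open Q \<and> (\<exists>K. compact K \<and> Q \<subseteq> K)"
proof -
  let ?P = "{Q::'a set. open Q \<and> (\<exists>K. compact K \<and> Q \<subseteq> K)}"
  obtain F where F: "F \<subseteq> ?P" "countable F" "\<Union>F = \<Union>?P"
    by (rule Lindelof[of ?P]) auto
  have "\<Union>?P = UNIV"
  proof (intro set_eqI iffI UNIV_I)
    fix x :: 'a
    from assms obtain U V where "open U" "compact V" "x \<in> U" "U \<subseteq> V"
      unfolding locally_def by (metis UNIV_I open_UNIV open_openin subtopology_UNIV)
    then show "x \<in> \<Union>?P" by auto
  qed
  with F show thesis by (intro that[of F]) auto
qed

lemma haar_measure_precompact_finite:
  fixes M :: "'a::{topological_group_add, t2_space} measure"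
  assumes "haar_measure M" "compact K" "Q \<subseteq> K"
  shows "emeasure M Q < \<infinity>"
proof -
  have "K \<in> sets M"
    using assms by (simp add: haar_measure_sets borel_compact)
  then have "emeasure M Q \<le> emeasure M K"
    using assms(3) by (intro emeasure_mono)
  also have "\<dots> < \<infinity>"
    using assms unfolding haar_measure_def by simp
  finally show ?thesis .
qed

lemma haar_measure_sigma_finite:
  fixes M :: "'a::{topological_group_add, second_countable_topology, t2_space} measure"
  assumes "haar_measure M" "locally compact (UNIV :: 'a set)"
  shows "sigma_finite_measure M"
proof
  obtain F :: "'a set set" where F: "countable F" "\<Union>F = UNIV"
    "\<And>Q. Q \<in> F \<Longrightarrow> open Q \<and> (\<exists>K. compact K \<and> Q \<subseteq> K)"
    by (rule countable_precompact_open_cover[OF assms(2)]) blast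
  then have "F \<subseteq> sets M" "\<forall>Q\<in>F. emeasure M Q \<noteq> \<infinity>"
    using haar_measure_precompact_finite[OF assms(1)]
    by (auto simp: haar_measure_sets[OF assms(1)]) (metis order_less_irrefl)
  with F show "\<exists>A. countable A \<and> A \<subseteq> sets M \<and> \<Union>A = space M \<and> (\<forall>a\<in>A. emeasure M a \<noteq> \<infinity>)"
    by (intro exI[of _ F]) (simp add: haar_measure_space[OF assms(1)])
qed

section \<open>Null sets under inversion and right translation\<close>

text \<open>Fubini applied to the set of all \<open>(x, y)\<close> with \<open>- y + x \<in> A\<close>: its sections in one
  direction are left translates of \<open>A\<close>, in the other left translates of \<open>- A\<close>.\<close>

lemma haar_measure_uminus_null:
  fixes M :: "'a::{topological_group_add, second_countable_topology, t2_space} measure"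
  assumes M: "haar_measure M" and lc: "locally compact (UNIV :: 'a set)" and A: "A \<in> null_sets M"
  shows "uminus ` A \<in> null_sets M"
proof -
  interpret sigma_finite_measure M
    by (rule haar_measure_sigma_finite[OF M lc])
  interpret pair_sigma_finite M M ..
  note [simp] = haar_measure_space[OF M]
  have Ab: "A \<in> sets borel"
    using A haar_measure_sets[OF M] by auto
  have sets_prod: "sets (M \<Otimes>\<^sub>M M) = sets (borel :: ('a \<times> 'a) measure)"
    using sets_pair_measure_cong[OF haar_measure_sets[OF M] haar_measure_sets[OF M]]
    unfolding borel_prod .
  have "(\<lambda>p::'a \<times> 'a. - snd p + fst p) \<in> borel_measurable borel"
    by (intro borel_measurable_continuous_onI continuous_intros)
  then have "(\<lambda>p. - snd p + fst p) -` (- A) \<in> sets (M \<Otimes>\<^sub>M M)"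
    unfolding sets_prod using Ab by (intro measurable_sets_borel[of _ borel]) auto
  moreover have "{p \<in> space (M \<Otimes>\<^sub>M M). - snd p + fst p \<notin> A} = (\<lambda>p. - snd p + fst p) -` (- A)"
    by (auto simp: space_pair_measure)
  ultimately have meas: "{p \<in> space (M \<Otimes>\<^sub>M M). - snd p + fst p \<notin> A} \<in> sets (M \<Otimes>\<^sub>M M)"
    by simp
  have "AE x in M. - y + x \<notin> A" for y
    using haar_measure_translate_null[OF M A, of y]
    by (intro AE_I'[of "(+) y ` A"]) (auto simp: left_translate_eq_vimage)
  then have "AE y in M. AE x in M. - y + x \<notin> A"
    by simp
  then have "AE x in M. AE y in M. - y + x \<notin> A"
    using AE_commute[of "\<lambda>x y. - y + x \<notin> A"] meas by simp
  \<comment> \<open>As \<open>M\<close> is not the zero measure, a property that holds almost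
    everywhere holds at some point \<open>x\<close>.\<close>
  moreover have "\<not> (AE x in M. False)"
    using M by (simp add: haar_measure_def AE_iff_null null_sets_def)
  ultimately obtain x where x: "AE y in M. - y + x \<notin> A"
    by (metis (mono_tags, lifting) eventually_mono)
  have "(\<lambda>y. - y + x) \<in> borel_measurable borel"
    by (intro borel_measurable_continuous_onI continuous_intros)
  then have "(\<lambda>y. - y + x) -` A \<in> sets M"
    using Ab haar_measure_sets[OF M] by (metis measurable_sets_borel)
  then have "(\<lambda>y. - y + x) -` A \<in> null_sets M"
    using AE_iff_null[of M "\<lambda>y. - y + x \<notin> A"] x by (simp add: vimage_def)
  \<comment> \<open>The section at \<open>x\<close> consists of the points \<open>x - a\<close> with
    \<open>a\<close> in \<open>A\<close>, so translating it by \<open>- x\<close> leaves the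
    inverses of \<open>A\<close>.\<close>
  then have "(+) (- x) ` ((\<lambda>y. - y + x) -` A) \<in> null_sets M"
    by (rule haar_measure_translate_null[OF M])
  moreover have "(+) (- x) ` ((\<lambda>y. - y + x) -` A) = uminus ` A"
  proof -
    have "(+) (- x) ` ((\<lambda>y. - y + x) -` A) = uminus -` A"
      by (simp add: left_translate_eq_vimage vimage_def minus_add add.assoc)
    also have "\<dots> = uminus ` A"
      by (force simp: image_iff)
    finally show ?thesis .
  qed
  ultimately show ?thesis by simp
qed

text \<open>A right translation is a left translation conjugated by inversion:
  \<open>a - z = - (z + (- a))\<close>.\<close>

lemma haar_measure_right_translate_null:
  fixes M :: "'a::{topological_group_add, second_countable_topology, t2_space} measure"
  assumes M: "haar_measure M" and lc: "locally compact (UNIV :: 'a set)" and A: "A \<in> null_sets M"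
  shows "(\<lambda>x. x + z) -` A \<in> null_sets M"
proof -
  have "uminus ` ((+) z ` (uminus ` A)) \<in> null_sets M"
    by (intro haar_measure_uminus_null haar_measure_translate_null M lc A)
  also have "uminus ` ((+) z ` (uminus ` A)) = (\<lambda>x. x + z) -` A"
    by (force simp: image_iff minus_add)
  finally show ?thesis .
qed

text \<open>A set of the completion is a Borel set together with part of a null set; right
  translation is continuous and keeps null sets null.\<close>

lemma haar_completion_right_translate:
  fixes M :: "'a::{topological_group_add, second_countable_topology, t2_space} measure"
  assumes M: "haar_measure M" and lc: "locally compact (UNIV :: 'a set)"
    and A: "A \<in> sets (completion M)"
  shows "(\<lambda>x. x + z) -` A \<in> sets (completion M)"
proof -
  obtain S N N' where *: "A = S \<union> N" "N \<subseteq> N'" "N' \<in> null_sets M" "S \<in> sets M"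
    using A by (rule sets_completionE)
  have "(\<lambda>x. x + z) \<in> borel_measurable borel"
    by (intro borel_measurable_continuous_onI continuous_intros)
  then have "(\<lambda>x. x + z) -` S \<in> sets M"
    using *(4) haar_measure_sets[OF M] by (metis measurable_sets_borel)
  with * haar_measure_right_translate_null[OF M lc *(3), of z] show ?thesis
    by (intro sets_completionI[of _ "(\<lambda>x. x + z) -` S" "(\<lambda>x. x + z) -` N" "(\<lambda>x. x + z) -` N'"]) auto
qed

section \<open>Steinhaus theorem\<close>

text \<open>Steinhaus: a compact \<open>K \<subseteq> A\<close> and an open \<open>P \<supseteq> K\<close> with measure less than twice that of \<open>K\<close>.
  Translates of \<open>K\<close> by elements close to \<open>0\<close> stay in \<open>P\<close>, so they cannot be disjoint from \<open>K\<close>.\<close>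

lemma steinhaus:
  fixes M :: "'a::{topological_group_add, polish_space} measure"
  assumes M: "haar_measure M" and lc: "locally compact (UNIV :: 'a set)"
    and A: "A \<in> sets (completion M)" "emeasure (completion M) A > 0"
  obtains V where "open V" "0 \<in> V" "\<And>g. g \<in> V \<Longrightarrow> \<exists>b\<in>A. g + b \<in> A"
proof -
  define S where "S = main_part M A"
  have S: "S \<in> sets M" "emeasure M S > 0" "S \<subseteq> A"
    using A main_part_null_part_Un[OF A(1)] unfolding S_def by (simp_all, blast)
  obtain F :: "'a set set" where F: "countable F" "\<Union>F = UNIV"
    "\<And>Q. Q \<in> F \<Longrightarrow> open Q \<and> (\<exists>K. compact K \<and> Q \<subseteq> K)"
    by (rule countable_precompact_open_cover[OF lc]) blast
  obtain Q where Q: "Q \<in> F" "emeasure M (S \<inter> Q) > 0"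
    using S F by (rule_tac positive_piece[of S M F id]) (auto simp: haar_measure_sets[OF M])
  have Q_sets: "Q \<in> sets M"
    using F(3)[OF Q(1)] by (simp add: haar_measure_sets[OF M])
  have Q_fin: "emeasure M Q < \<infinity>"
    using F(3)[OF Q(1)] haar_measure_precompact_finite[OF M] by blast
  \<comment> \<open>The restriction of \<open>M\<close> to \<open>Q\<close> is a finite Borel
    measure on a Polish space, hence inner and outer regular.\<close>
  define N where "N = density M (indicator Q)"
  have N: "emeasure N X = emeasure M (Q \<inter> X)" if "X \<in> sets borel" for X
    using that Q_sets by (simp add: N_def emeasure_restricted haar_measure_sets[OF M])
  have N_sets: "sets N = sets borel"
    by (simp add: N_def haar_measure_sets[OF M])
  have N_space: "space N = UNIV"
    using N_sets by (metis sets_eq_imp_space_eq space_borel)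
  have N_fin: "emeasure N (space N) \<noteq> \<infinity>"
    using Q_fin by (simp add: N_space N)
  have SQ: "S \<inter> Q \<in> sets borel"
    using S Q_sets by (simp add: haar_measure_sets[OF M])
  then have "0 < emeasure N (S \<inter> Q)"
    using Q(2) by (simp add: N Int_left_absorb Int_commute)
  then obtain K where K: "K \<subseteq> S \<inter> Q" "compact K" "emeasure N K > 0"
    unfolding inner_regular[OF N_sets N_fin SQ] less_SUP_iff by auto
  have K_sets: "K \<in> sets borel"
    using K(2) by (simp add: borel_compact)
  have NK: "emeasure N K = emeasure M K"
    using K(1) N[OF K_sets] by (simp add: Int_absorb1)
  have "emeasure N K < \<infinity>"
    using M K(2) unfolding NK haar_measure_def by simp
  then have "emeasure N K < 2 * emeasure N K"
    using K(3) by (cases "emeasure N K") (auto simp: ennreal_mult[symmetric] ennreal_less_iff simp flip: ennreal_numeral)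
  then obtain P where P: "K \<subseteq> P" "open P" "emeasure N P < 2 * emeasure N K"
    using outer_regular[OF N_sets N_fin K_sets] unfolding INF_less_iff by (auto simp: INF_less_iff)
  \<comment> \<open>Inside \<open>Q\<close> the measures \<open>N\<close> and \<open>M\<close>
    agree, so the bound on \<open>N\<close> becomes one on \<open>M\<close>.\<close>
  define P' where "P' = P \<inter> Q"
  have P': "open P'" "K \<subseteq> P'" "emeasure M P' < 2 * emeasure M K"
    using P K(1) F(3)[OF Q(1)] N[of P] unfolding NK P'_def by (auto simp: Int_commute)
  \<comment> \<open>Compactness of \<open>K\<close> gives one \<open>V\<close> that works for all
    points of \<open>K\<close>, by the tube lemma.\<close>
  have "open ((\<lambda>p. fst p + snd p) -` P')"
    by (intro open_vimage continuous_intros P')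
  moreover have "{0} \<times> K \<subseteq> (\<lambda>p. fst p + snd p) -` P'"
    using P'(2) by auto
  ultimately have "\<exists>V. 0 \<in> V \<and> open V \<and> V \<times> K \<subseteq> (\<lambda>p. fst p + snd p) -` P'"
    by (rule Elementary_Topology.tube_lemma[OF K(2)])
  then obtain V where V: "0 \<in> V" "open V" "V \<times> K \<subseteq> (\<lambda>p. fst p + snd p) -` P'"
    by blast
  have "\<exists>b\<in>A. g + b \<in> A" if g: "g \<in> V" for g
  proof (rule ccontr)
    assume "\<not> ?thesis"
    then have "(+) g ` K \<inter> K = {}"
      using K(1) S(3) by auto
    then have "emeasure M ((+) g ` K \<union> K) = 2 * emeasure M K"
      using K_sets haar_measure_translate[OF M, of K g]
      by (subst plus_emeasure[symmetric]) (auto simp: haar_measure_sets[OF M] mult_2)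
    moreover have "(+) g ` K \<union> K \<subseteq> P'"
      using V(3) g P'(2) by auto
    ultimately have "2 * emeasure M K \<le> emeasure M P'"
      using P'(1) emeasure_mono[of "(+) g ` K \<union> K" P' M] by (simp add: haar_measure_sets[OF M])
    with P'(3) show False by simp
  qed
  with V that show thesis by blast
qed

section \<open>Open sets of small oscillation\<close>

text \<open>The differences in parentheses are small when \<open>g + b\<close> and \<open>b\<close> lie in the set \<open>L\<close> below; \<open>h\<close> is a
  value that \<open>f\<close> approximates on \<open>L\<close>.\<close>

lemma left_diff_regroup:
  fixes f :: "'a::group_add \<Rightarrow> 'b::group_add"
  shows "left_diff g f (b + x) =
    (left_diff (g + b) f x - left_diff (g + b) f 0)
      - ((f b - h) - (f (g + b) - h)) - (left_diff b f x - left_diff b f 0)"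
  unfolding left_diff_def
  by (simp add: add.assoc minus_add diff_conv_add_uminus del: add_uminus_conv_diff)

lemma small_oscillation:
  fixes f :: "'a::{topological_group_add, polish_space} \<Rightarrow> 'b::{topological_group_add, polish_space}"
  assumes M: "haar_measure M" and lc: "locally compact (UNIV :: 'a set)"
    and f: "f \<in> borel_measurable (completion M)"
    and cont: "\<And>g. continuous_on UNIV (left_diff g f)"
    and B: "open B" "B \<noteq> {}" and W: "open W" "0 \<in> W"
  obtains U where "open U" "U \<noteq> {}" "U \<subseteq> B" "\<And>u v. u \<in> U \<Longrightarrow> v \<in> U \<Longrightarrow> f u - f v \<in> W"
proof -
  let ?N = "completion M"
  note [simp] = haar_measure_space[OF M]
  \<comment> \<open>The step from \<open>V1\<close> to \<open>W\<close> compares two values of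
    \<open>f\<close> through \<open>f x0\<close>; the three steps from \<open>V4\<close> to
    \<open>V1\<close> absorb the nested differences of \<open>left_diff_regroup\<close>.\<close>
  obtain V1 where V1: "open V1" "0 \<in> V1" "\<And>a b. a \<in> closure V1 \<Longrightarrow> b \<in> closure V1 \<Longrightarrow> a - b \<in> W"
    using nbhd_diff[OF W] by metis
  obtain V2 where V2: "open V2" "0 \<in> V2" "\<And>a b. a \<in> closure V2 \<Longrightarrow> b \<in> closure V2 \<Longrightarrow> a - b \<in> V1"
    using nbhd_diff[OF V1(1,2)] by metis
  obtain V3 where V3: "open V3" "0 \<in> V3" "\<And>a b. a \<in> closure V3 \<Longrightarrow> b \<in> closure V3 \<Longrightarrow> a - b \<in> V2"
    using nbhd_diff[OF V2(1,2)] by metis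
  obtain V4 where V4: "open V4" "0 \<in> V4" "\<And>a b. a \<in> closure V4 \<Longrightarrow> b \<in> closure V4 \<Longrightarrow> a - b \<in> V3"
    using nbhd_diff[OF V3(1,2)] by metis
  have C: "p - (s - r) - q \<in> V1"
    if "p \<in> closure V4" "q \<in> closure V4" "r \<in> closure V4" "s \<in> closure V4" for p q r s
  proof -
    have z: "0 \<in> closure V3" "0 \<in> closure V4"
      using V3(2) V4(2) closure_subset by blast+
    have "p \<in> V3" "s - r \<in> V3" "q \<in> V3"
      using V4(3)[of p 0] V4(3)[of s r] V4(3)[of q 0] that z by auto
    then have "p \<in> closure V3" "s - r \<in> closure V3" "q \<in> closure V3"
      using closure_subset by blast+
    then have "p - (s - r) \<in> V2" "q \<in> V2"
      using V3(3)[of p "s - r"] V3(3)[of q 0] z by auto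
    then show ?thesis
      using V2(3) closure_subset by blast
  qed

  obtain D :: "'a set" where D: "countable D" "\<And>X. open X \<Longrightarrow> X \<noteq> {} \<Longrightarrow> \<exists>d\<in>D. d \<in> X"
    by (rule countable_dense_setE) blast
  \<comment> \<open>Testing only points of the countable set \<open>D\<close> makes
    \<open>A n\<close> measurable; since \<open>closure V4\<close> is closed and \<open>D\<close> is
    dense, the condition extends to the whole ball.\<close>
  define A where "A n = {g. \<forall>x\<in>D \<inter> ball 0 (1 / Suc n). left_diff g f x - left_diff g f 0 \<in> closure V4}"
    for n :: nat
  have A_ball: "left_diff g f x - left_diff g f 0 \<in> closure V4"
    if "g \<in> A n" "x \<in> ball 0 (1 / Suc n)" for g n x
  proof -
    let ?X = "(\<lambda>x. left_diff g f x - left_diff g f 0) -` closure V4"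
    have "closed ?X"
      by (intro closed_vimage closed_closure continuous_intros cont)
    have "closure D = UNIV"
      using D(2)[of "- closure D"] closure_subset[of D] by auto
    then have "ball 0 (1 / Suc n) \<subseteq> closure (ball 0 (1 / Suc n) \<inter> D)"
      using open_Int_closure_subset[of "ball 0 (1 / Suc n)" D] by simp
    also have "\<dots> \<subseteq> ?X"
      using that(1) \<open>closed ?X\<close> by (intro closure_minimal) (auto simp: A_def)
    finally show ?thesis using that(2) by auto
  qed
  have A_sets: "A n \<in> sets ?N" for n
  proof -
    have 1: "(\<lambda>g. f (g + x)) \<in> borel_measurable ?N" for x
    proof (rule borel_measurableI)
      fix S :: "'b set" assume "open S"
      then have "f -` S \<in> sets ?N"
        using measurable_sets[OF f, of S] by simp
      from haar_completion_right_translate[OF M lc this, of x]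
      show "(\<lambda>g. f (g + x)) -` S \<inter> space ?N \<in> sets ?N"
        by (simp add: vimage_def)
    qed
    have 2: "(\<lambda>g. left_diff g f x) \<in> borel_measurable ?N" for x
      unfolding left_diff_def
      by (rule borel_measurable_continuous_on[OF _ 1]) (intro continuous_intros)
    have 3: "(\<lambda>g. left_diff g f x - left_diff g f 0) \<in> borel_measurable ?N" for x
      by (rule borel_measurable_continuous_Pair[OF 2 2]) (intro continuous_intros)
    have "{g \<in> space ?N. left_diff g f x - left_diff g f 0 \<in> closure V4} \<in> sets ?N" for x
      using measurable_sets[OF 3[of x], of "closure V4"] by (simp add: vimage_def)
    then have "{g \<in> space ?N. \<forall>x\<in>D \<inter> ball 0 (1 / Suc n). left_diff g f x - left_diff g f 0 \<in> closure V4}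
        \<in> sets ?N"
      using D(1) by (intro sets.sets_Collect_countable_All') auto
    then show ?thesis by (simp add: A_def)
  qed
  have A_UN: "(\<Union>n. A n) = UNIV"
  proof (intro set_eqI iffI UNIV_I)
    fix g
    have "open ((\<lambda>x. left_diff g f x - left_diff g f 0) -` V4)"
      by (intro open_vimage V4 continuous_intros cont)
    then obtain e where e: "e > 0" "ball 0 e \<subseteq> (\<lambda>x. left_diff g f x - left_diff g f 0) -` V4"
      using V4(2) open_contains_ball by (metis (no_types, lifting) diff_self vimageI)
    obtain n where "1 / Suc n < e"
      using e(1) nat_approx_posE by blast
    then have "ball 0 (1 / Suc n) \<subseteq> (\<lambda>x. left_diff g f x - left_diff g f 0) -` V4"
      using e(2) by (meson order_trans subset_ball less_imp_le)
    then have "g \<in> A n"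
      using closure_subset[of V4] by (auto simp: A_def)
    then show "g \<in> (\<Union>n. A n)" by auto
  qed

  have B_sets: "B \<in> sets ?N"
    using B(1) by (intro sets_completionI_sets) (simp add: haar_measure_sets[OF M])
  have "emeasure ?N B > 0"
    using haar_measure_open_pos[OF M B] B_sets B(1) by (simp add: haar_measure_sets[OF M])
  then obtain n where n: "emeasure ?N (B \<inter> A n) > 0"
    using A_UN B_sets A_sets by (rule_tac positive_piece[of B ?N UNIV A]) auto

  \<comment> \<open>If \<open>b\<close> and \<open>x0\<close> lie in a common left translate of
    \<open>E\<close>, the translating element cancels in \<open>- b + x0\<close>, which therefore
    lies in the ball.\<close>
  obtain E :: "'a set" where E: "open E" "0 \<in> E" "\<And>a b. a \<in> E \<Longrightarrow> b \<in> E \<Longrightarrow> - a + b \<in> ball 0 (1 / Suc n)"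
  proof -
    have "open ((\<lambda>p::'a \<times> 'a. - fst p + snd p) -` ball 0 (1 / Suc n))"
      by (intro open_vimage continuous_intros open_ball)
    then obtain E1 E2 where "open E1" "open E2" "(0, 0) \<in> E1 \<times> E2"
        "E1 \<times> E2 \<subseteq> (\<lambda>p::'a \<times> 'a. - fst p + snd p) -` ball 0 (1 / Suc n)"
      by (rule open_prod_elim[of _ "(0, 0)"]) auto
    then show thesis
      by (intro that[of "E1 \<inter> E2"]) auto
  qed
  obtain T where T: "countable T" "(\<Union>g\<in>T. (+) g ` E) = UNIV"
    using countable_left_translates_cover[OF E(1,2)] .
  have T_sets: "(+) g ` E \<in> sets ?N" for g
    using open_left_translate[OF E(1)]
    by (intro sets_completionI_sets) (simp add: haar_measure_sets[OF M])
  obtain t where t: "emeasure ?N (B \<inter> A n \<inter> (+) t ` E) > 0"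
    using n B_sets A_sets T T_sets
    by (rule_tac positive_piece[of "B \<inter> A n" ?N T "\<lambda>g. (+) g ` E"]) auto

  \<comment> \<open>Right translates are chosen so that \<open>f b\<close> in \<open>V4 + h\<close>
    means that \<open>f b - h\<close> lies in \<open>V4\<close>.\<close>
  obtain R where R: "countable R" "(\<Union>h\<in>R. (\<lambda>y. y + h) ` V4) = UNIV"
    using countable_right_translates_cover[OF V4(1,2)] .
  have R_sets: "f -` (\<lambda>y. y + h) ` V4 \<in> sets ?N" for h
    using measurable_sets[OF f, of "(\<lambda>y. y + h) ` V4"] open_right_translate[OF V4(1)] by simp
  have "B \<inter> A n \<inter> (+) t ` E \<subseteq> (\<Union>h\<in>R. f -` (\<lambda>y. y + h) ` V4)"
    unfolding vimage_UN[symmetric] R(2) by simp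
  then obtain h where h: "emeasure ?N (B \<inter> A n \<inter> (+) t ` E \<inter> f -` (\<lambda>y. y + h) ` V4) > 0"
    using t B_sets A_sets T_sets R(1) R_sets
    by (rule_tac positive_piece[of "B \<inter> A n \<inter> (+) t ` E" ?N R "\<lambda>h. f -` (\<lambda>y. y + h) ` V4"]) auto

  define L where "L = B \<inter> A n \<inter> (+) t ` E \<inter> f -` (\<lambda>y. y + h) ` V4"
  have L: "L \<in> sets ?N" "emeasure ?N L > 0"
    using h B_sets A_sets T_sets R_sets unfolding L_def by auto
  then obtain x0 where x0: "x0 \<in> L"
    by (metis emeasure_empty equals0I order_less_irrefl)
  obtain V where V: "open V" "0 \<in> V" "\<And>g. g \<in> V \<Longrightarrow> \<exists>b\<in>L. g + b \<in> L"
    using steinhaus[OF M lc L] by metis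
  have Lh: "f b - h \<in> closure V4" if "b \<in> L" for b
    using that closure_subset[of V4] unfolding L_def by auto
  have near: "f u - f x0 \<in> V1" if u: "u - x0 \<in> V" for u
  proof -
    define g where "g = u - x0"
    obtain b where b: "b \<in> L" "g + b \<in> L"
      using V(3)[OF u] unfolding g_def by blast
    \<comment> \<open>With this choice \<open>b + x = x0\<close>, so
      \<open>left_diff g f (b + x)\<close> is \<open>f u - f x0\<close>, whichever \<open>b\<close>
      was found.\<close>
    define x where "x = - b + x0"
    have "x \<in> ball 0 (1 / Suc n)"
    proof -
      obtain a c where "b = t + a" "a \<in> E" "x0 = t + c" "c \<in> E"
        using b(1) x0 unfolding L_def by auto
      moreover from this have "x = - a + c"
        by (simp add: x_def minus_add add.assoc diff_conv_add_uminus del: add_uminus_conv_diff)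
      ultimately show ?thesis
        using E(3) by simp
    qed
    then have "left_diff (g + b) f x - left_diff (g + b) f 0 \<in> closure V4"
      "left_diff b f x - left_diff b f 0 \<in> closure V4"
      using A_ball[of _ n] b unfolding L_def by blast+
    then have "left_diff g f (b + x) \<in> V1"
      unfolding left_diff_regroup[where h = h] using b by (intro C Lh)
    moreover have "b + x = x0" "g + x0 = u"
      by (simp_all add: x_def g_def add.assoc[symmetric])
    ultimately show ?thesis
      by (simp add: left_diff_def)
  qed
  show thesis
  proof (rule that[of "B \<inter> (\<lambda>u. u - x0) -` V"])
    show "open (B \<inter> (\<lambda>u. u - x0) -` V)"
      by (intro open_Int B open_vimage V continuous_intros)
    show "B \<inter> (\<lambda>u. u - x0) -` V \<noteq> {}"
      using x0 V(2) unfolding L_def by auto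
    fix u v assume "u \<in> B \<inter> (\<lambda>u. u - x0) -` V" "v \<in> B \<inter> (\<lambda>u. u - x0) -` V"
    then have "f u - f x0 \<in> closure V1" "f v - f x0 \<in> closure V1"
      using near closure_subset[of V1] by auto
    \<comment> \<open>The terms \<open>f x0\<close> cancel without commutativity, leaving
      \<open>f u - f v\<close>.\<close>
    then have "(f u - f x0) - (f v - f x0) \<in> W"
      by (rule V1(3))
    then show "f u - f v \<in> W"
      by (simp add: minus_diff_eq diff_conv_add_uminus add.assoc minus_add del: add_uminus_conv_diff)
  qed auto
qed

section \<open>A point of continuity by Baire category, and its translation\<close>

text \<open>The union \<open>G k\<close> of the open sets on which \<open>f\<close> varies by less
  than \<open>1 / Suc k\<close> is dense, since by \<open>osc\<close> every nonempty open set
  contains a nonempty one of them. Baire gives a point in all \<open>G k\<close>, and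
  \<open>f\<close> is continuous there.\<close>

lemma ex_continuity_point:
  fixes f :: "'a::{topological_group_add, polish_space} \<Rightarrow> 'b::{topological_group_add, metric_space}"
  assumes osc: "\<And>B W. open B \<Longrightarrow> B \<noteq> {} \<Longrightarrow> open W \<Longrightarrow> 0 \<in> W \<Longrightarrow>
    \<exists>U. open U \<and> U \<noteq> {} \<and> U \<subseteq> B \<and> (\<forall>u\<in>U. \<forall>v\<in>U. f u - f v \<in> W)"
  obtains x where "isCont f x"
proof -
  define G where "G k = \<Union>{U. open U \<and> (\<forall>u\<in>U. \<forall>v\<in>U. f u - f v \<in> ball 0 (1 / Suc k))}" for k :: nat
  have "open (G k)" for k
    by (auto simp: G_def)
  moreover have "closure (G k) = UNIV" for k
  proof (rule ccontr)
    assume "closure (G k) \<noteq> UNIV"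
    then have "open (- closure (G k))" "- closure (G k) \<noteq> {}"
      by auto
    then obtain U where "open U" "U \<noteq> {}" "U \<subseteq> - closure (G k)"
        "\<forall>u\<in>U. \<forall>v\<in>U. f u - f v \<in> ball 0 (1 / Suc k)"
      using osc[of "- closure (G k)" "ball 0 (1 / Suc k)"] by auto
    moreover from this have "U \<subseteq> closure (G k)"
      using closure_subset[of "G k"] unfolding G_def by blast
    ultimately show False by auto
  qed
  ultimately have "euclidean closure_of \<Inter>(range G) = topspace (euclidean :: 'a topology)"
    by (intro Baire_category) (auto simp: completely_metrizable_space_euclidean)
  then have "\<Inter>(range G) \<noteq> {}"
    by force
  then obtain x where x: "\<And>k. x \<in> G k"
    by blast
  have "((\<lambda>u. f u - f x) \<longlongrightarrow> 0) (at x)"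
  proof (rule tendstoI)
    fix e :: real assume "e > 0"
    then obtain k where k: "1 / Suc k < e"
      using nat_approx_posE by blast
    obtain U where U: "open U" "x \<in> U" "\<forall>u\<in>U. \<forall>v\<in>U. f u - f v \<in> ball 0 (1 / Suc k)"
      using x[of k] unfolding G_def by auto
    then have "dist (f u - f x) 0 < e" if "u \<in> U" for u
      using that k by (force simp: dist_commute)
    with U show "eventually (\<lambda>u. dist (f u - f x) 0 < e) (at x)"
      unfolding eventually_at_topological by blast
  qed
  from tendsto_add[OF this tendsto_const[of "f x"]] have "isCont f x"
    by (simp add: isCont_def)
  then show thesis by (rule that)
qed

theorem theorem1p5:
  fixes f :: "'a::{topological_group_add, polish_space} \<Rightarrow> 'b::{topological_group_add, polish_space}"
  assumes "locally compact (UNIV :: 'a set)"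
    and "locally compact (UNIV :: 'b set)"
    and "haar_measurable f"
    and "\<And>g. continuous_on UNIV (left_diff g f)"
  shows "continuous_on UNIV f"
proof -
  obtain M where M: "haar_measure M" and f: "\<And>U. open U \<Longrightarrow> f -` U \<in> sets (completion M)"
    using assms(3) unfolding haar_measurable_def by auto
  have "f \<in> borel_measurable (completion M)"
    by (rule borel_measurableI) (simp add: f haar_measure_space[OF M])
  then obtain x where x: "isCont f x"
    using small_oscillation[OF M assms(1) _ assms(4)] by (metis ex_continuity_point)
  have "isCont f y" for y
  proof -
    define g where "g = y - x"
    have [simp]: "- g + y = x"
      by (simp add: g_def)
    have shift: "isCont (\<lambda>u. - g + u) y"
      by (intro continuous_intros)
    have "isCont (left_diff g f) x"
      using assms(4) by (simp add: continuous_on_eq_continuous_at)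
    \<comment> \<open>As \<open>u\<close> tends to \<open>y\<close>, the point
      \<open>- g + u\<close> tends to \<open>x\<close>, where both summands are continuous.\<close>
    with shift x have "isCont (\<lambda>u. left_diff g f (- g + u) + f (- g + u)) y"
      by (intro continuous_add isCont_o2[OF shift]) auto
    also have "(\<lambda>u. left_diff g f (- g + u) + f (- g + u)) = f"
      by (simp add: left_diff_def fun_eq_iff add.assoc[symmetric])
    finally show ?thesis .
  qed
  then show ?thesis
    by (simp add: continuous_on_eq_continuous_at)
qed

end
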